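(* Let $\mathcal{I}=(V,E,[q],\Phi)$ be a graphical model and $(D,\Phi_D)$ an update to $\mathcal{I}$ producing $\mathcal{I}'=(V,E',[q],\Phi')$. Assume that for every $e\in E'$ we have $\phi'_e:[q]^e\to[B_e,1]$ for some $0<B_e\le1$, and that there is a constant $0<\delta<1$ such that for all $e\in E'$, $B_e\ge\left(1-\frac{1-\delta}{d+1}\right)^{1/2}$, where $d\triangleq\max_{e\in E}|\Gamma(e)|$ is the maximum degree of the dependency graph of $\mathcal{I}'$. Then the Dynamic Sampler (run on $\mathcal{I}$, a sample $\boldsymbol{X}$, and the update $(D,\Phi_D)$) terminates within $O(\log|D|)$ iterations of its while loop in expectation. Further, if $d=O(1)$ and $\max_{e\in E}|e|=O(1)$, the total number of resamplings is bounded by $O(|D|)$ in expectation.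
   Context: A graphical model is $\mathcal{I}=(V,E,[q],\Phi)$: $V$ finite set of variables with domain $[q]$; $E\subseteq2^V$ constraints with $|e|>1$; $\phi_v:[q]\to\mathbb{R}_{\ge0}$ a probability distribution for each $v\in V$, $\phi_e:[q]^e\to[0,1]$ for each $e\in E$. Gibbs distribution $\mu_{\mathcal{I}}(\sigma)\propto\prod_v\phi_v(\sigma_v)\prod_e\phi_e(\sigma_e)$. The dependency graph has vertex set $E$, with $e,f$ adjacent iff $e\cap f\neq\emptyset$; $\Gamma(e)=\{f\in E\setminus\{e\}: f\cap e\neq\emptyset\}$. For $S\subseteq V$: $E(S)=\{e:e\subseteq S\}$, $\delta(S)=\{e:e\not\subseteq S,e\cap S\ne\emptyset\}$, $E^+(S)=E(S)\cup\delta(S)$; $\mathrm{vbl}(D)$ is the set of variables in $D$ together with all variables of constraints in $D$. An update $(D,\Phi_D)$: $D$ consists of variables, existing constraints, or new constraints $e\subseteq V$ with $|e|>1$, and $\Phi_D$ gives their new functions; applying it yields $\mathcal{I}'$. Local-Resample$(\mathcal{I},\boldsymbol{X},\mathcal{R})$: for each $e\in E^+(\mathcal{R})$ compute $\kappa_e=\frac{1}{\phi_e(X_e)}\min_{x\in[q]^e:x_{e\cap\mathcal{R}}=X_{e\cap\mathcal{R}}}\phi_e(x)$ (with $0/0=1$) from the current $\boldsymbol{X}$; resample each $X_v$, $v\in\mathcal{R}$, independently from $\phi_v$; for each $e\in E^+(\mathcal{R})$ independently draw $F_e\in\{0,1\}$ with $\Pr[F_e=0]=\kappa_e\phi_e(X_e)$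 evaluated at the resampled $X$; return $(\boldsymbol{X},\bigcup_{e:F_e=1}e)$. Dynamic Sampler: $\mathcal{R}\gets\mathrm{vbl}(D)$; while $\mathcal{R}\ne\emptyset$, $(\boldsymbol{X},\mathcal{R})\gets$ Local-Resample$(\mathcal{I}',\boldsymbol{X},\mathcal{R})$; return $\boldsymbol{X}$. The number of resamplings is the total number of individual samplings of values $X_v\in[q]$ and indicators $F_e\in\{0,1\}$ performed during the execution. *)

theory Defs
  imports "HOL-Probability.SPMF" "HOL-Probability.Product_PMF"
begin

record 'v graphical_model =
  gm_vars :: "'v set"
  gm_cons :: "'v set set"
  gm_q :: nat
  gm_phi_v :: "'v \<Rightarrow> nat pmf"
  gm_phi_c :: "'v set \<Rightarrow> ('v \<Rightarrow> nat) \<Rightarrow> real"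

definition assignments :: "'v graphical_model \<Rightarrow> 'v set \<Rightarrow> ('v \<Rightarrow> nat) set" where
  "assignments I S = S \<rightarrow>\<^sub>E {1..gm_q I}"

definition is_graphical_model :: "'v graphical_model \<Rightarrow> bool" where
  "is_graphical_model I \<longleftrightarrow>
     finite (gm_vars I) \<and>
     (\<forall>e\<in>gm_cons I. e \<subseteq> gm_vars I \<and> 1 < card e) \<and>
     (\<forall>v\<in>gm_vars I. set_pmf (gm_phi_v I v) \<subseteq> {1..gm_q I}) \<and>
     (\<forall>e\<in>gm_cons I. \<forall>x\<in>assignments I e. gm_phi_c I e x \<in> {0..1})"

definition weight :: "'v graphical_model \<Rightarrow> ('v \<Rightarrow> nat) \<Rightarrow> real" where
  "weight I \<sigma> = (\<Prod>v\<in>gm_vars I. pmf (gm_phi_v I v) (\<sigma> v)) *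
     (\<Prod>e\<in>gm_cons I. gm_phi_c I e (restrict \<sigma> e))"

text \<open>If all weights vanish, the Gibbs distribution does not exist, and indeed no
  \<open>\<mu>\<close> satisfies the following predicate, since a pmf is not identically zero.\<close>

definition is_gibbs :: "'v graphical_model \<Rightarrow> ('v \<Rightarrow> nat) pmf \<Rightarrow> bool" where
  "is_gibbs I \<mu> \<longleftrightarrow> (\<forall>\<sigma>. pmf \<mu> \<sigma> =
     (if \<sigma> \<in> assignments I (gm_vars I)
      then weight I \<sigma> / (\<Sum>\<tau>\<in>assignments I (gm_vars I). weight I \<tau>) else 0))"

definition dep_neighbours :: "'v graphical_model \<Rightarrow> 'v set \<Rightarrow> 'v set set" where
  "dep_neighbours I e = {f \<in> gm_cons I - {e}. f \<inter> e \<noteq> {}}"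

text \<open>The maximum over an empty set of constraints is taken to be \<open>0\<close>.\<close>

definition max_dep_degree :: "'v graphical_model \<Rightarrow> nat" where
  "max_dep_degree I = Max (insert 0 ((\<lambda>e. card (dep_neighbours I e)) ` gm_cons I))"

definition internal_cons :: "'v graphical_model \<Rightarrow> 'v set \<Rightarrow> 'v set set" where
  "internal_cons I S = {e \<in> gm_cons I. e \<subseteq> S}"

definition boundary_cons :: "'v graphical_model \<Rightarrow> 'v set \<Rightarrow> 'v set set" where
  "boundary_cons I S = {e \<in> gm_cons I. \<not> e \<subseteq> S \<and> e \<inter> S \<noteq> {}}"

definition incident_cons :: "'v graphical_model \<Rightarrow> 'v set \<Rightarrow> 'v set set" where
  "incident_cons I S = internal_cons I S \<union> boundary_cons I S"

text \<open>In an update \<open>(D, \<Phi>\<^sub>D)\<close>, the set \<open>D\<close> contains variables (\<open>Inl\<close>) and constraints (\<open>Inr\<close>);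
  the two function fields are relevant only on \<open>D\<close>.\<close>

record 'v gm_update =
  upd_set :: "('v + 'v set) set"
  upd_phi_v :: "'v \<Rightarrow> nat pmf"
  upd_phi_c :: "'v set \<Rightarrow> ('v \<Rightarrow> nat) \<Rightarrow> real"

text \<open>Existing constraints already satisfy the condition imposed on the constraints in \<open>D\<close>.\<close>

definition is_update :: "'v graphical_model \<Rightarrow> 'v gm_update \<Rightarrow> bool" where
  "is_update I U \<longleftrightarrow>
     (\<forall>v. Inl v \<in> upd_set U \<longrightarrow>
        v \<in> gm_vars I \<and> set_pmf (upd_phi_v U v) \<subseteq> {1..gm_q I}) \<and>
     (\<forall>e. Inr e \<in> upd_set U \<longrightarrow>
        e \<subseteq> gm_vars I \<and> 1 < card e \<and>
        (\<forall>x\<in>assignments I e. upd_phi_c U e x \<in> {0..1}))"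

definition apply_update :: "'v graphical_model \<Rightarrow> 'v gm_update \<Rightarrow> 'v graphical_model" where
  "apply_update I U =
     \<lparr> gm_vars = gm_vars I,
       gm_cons = gm_cons I \<union> {e. Inr e \<in> upd_set U},
       gm_q = gm_q I,
       gm_phi_v = (\<lambda>v. if Inl v \<in> upd_set U then upd_phi_v U v else gm_phi_v I v),
       gm_phi_c = (\<lambda>e. if Inr e \<in> upd_set U then upd_phi_c U e else gm_phi_c I e) \<rparr>"

definition vbl :: "('v + 'v set) set \<Rightarrow> 'v set" where
  "vbl D = {v. Inl v \<in> D} \<union> \<Union>{e. Inr e \<in> D}"

text \<open>The convention \<open>0/0 = 1\<close> is made explicit.\<close>

definition kappa :: "'v graphical_model \<Rightarrow> ('v \<Rightarrow> nat) \<Rightarrow> 'v set \<Rightarrow> 'v set \<Rightarrow> real" where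
  "kappa I X R e =
     (let m = Min (gm_phi_c I e `
                {x \<in> assignments I e. restrict x (e \<inter> R) = restrict X (e \<inter> R)});
          p = gm_phi_c I e (restrict X e)
      in if m = 0 \<and> p = 0 then 1 else m / p)"

text \<open>\<open>F e = True\<close> encodes \<open>F\<^sub>e = 1\<close>.  The factor \<open>kappa\<close> refers to the old configuration \<open>X\<close>,
  the constraint function to the resampled configuration \<open>X'\<close>.\<close>

definition local_resample ::
    "'v graphical_model \<Rightarrow> ('v \<Rightarrow> nat) \<Rightarrow> 'v set \<Rightarrow> (('v \<Rightarrow> nat) \<times> 'v set) pmf" where
  "local_resample I X R =
     bind_pmf (Pi_pmf R undefined (gm_phi_v I)) (\<lambda>Y.
       let X' = (\<lambda>v. if v \<in> R then Y v else X v) in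
       bind_pmf (Pi_pmf (incident_cons I R) False
           (\<lambda>e. bernoulli_pmf (1 - kappa I X R e * gm_phi_c I e (restrict X' e)))) (\<lambda>F.
         return_pmf (X', \<Union>{e \<in> incident_cons I R. F e})))"

text \<open>The while loop, instrumented with two counters: \<open>t\<close> counts iterations, \<open>n\<close> counts
  individual samplings (one per variable of \<open>R\<close> and one per indicator).  The mass that the
  resulting subprobability distribution assigns to \<open>None\<close> is the probability of nontermination.\<close>

partial_function (spmf) sampler_loop ::
    "'v graphical_model \<Rightarrow> ('v \<Rightarrow> nat) \<Rightarrow> 'v set \<Rightarrow> nat \<Rightarrow> nat \<Rightarrow> (('v \<Rightarrow> nat) \<times> nat \<times> nat) spmf"
  where
  "sampler_loop I X R t n =
     (if R = {} then return_spmf (X, t, n)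
      else bind_spmf (spmf_of_pmf (local_resample I X R)) (\<lambda>(X', R').
        sampler_loop I X' R' (t + 1) (n + card R + card (incident_cons I R))))"

definition dynamic_sampler ::
    "'v graphical_model \<Rightarrow> ('v \<Rightarrow> nat) \<Rightarrow> 'v gm_update \<Rightarrow> (('v \<Rightarrow> nat) \<times> nat \<times> nat) spmf" where
  "dynamic_sampler I X U = sampler_loop (apply_update I U) X (vbl (upd_set U)) 0 0"

text \<open>The sampler run on a random input drawn from \<open>\<mu>\<close>.\<close>

definition sampler_run ::
    "'v graphical_model \<Rightarrow> ('v \<Rightarrow> nat) pmf \<Rightarrow> 'v gm_update \<Rightarrow> (('v \<Rightarrow> nat) \<times> nat \<times> nat) spmf" where
  "sampler_run I \<mu> U = bind_pmf \<mu> (\<lambda>X. dynamic_sampler I X U)"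

text \<open>Nonterminating runs count as infinite.\<close>

definition expected_iterations :: "('x \<times> nat \<times> nat) spmf \<Rightarrow> ennreal" where
  "expected_iterations P =
     (\<integral>\<^sup>+\<omega>. (case \<omega> of None \<Rightarrow> \<infinity> | Some (_, t, _) \<Rightarrow> of_nat t) \<partial>measure_pmf P)"

definition expected_resamplings :: "('x \<times> nat \<times> nat) spmf \<Rightarrow> ennreal" where
  "expected_resamplings P =
     (\<integral>\<^sup>+\<omega>. (case \<omega> of None \<Rightarrow> \<infinity> | Some (_, _, n) \<Rightarrow> of_nat n) \<partial>measure_pmf P)"

end

theory Submission
  imports Defs
begin

text \<open>
  Cover the current region by a set \<open>D\<close> of variables and constraints with \<open>\<R> = vbl(D)\<close>.
  Constraints sharing a variable are adjacent in the dependency graph, so at most \<open>(d+1)|D|\<close>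
  constraints are incident to \<open>\<R>\<close>. Each indicator fails with probability at most
  \<open>1 - B\<^sub>e\<^sup>2 \<le> (1-\<delta>)/(d+1)\<close>, and the failed constraints cover the next region. Hence the expected
  size of the cover shrinks by the factor \<open>1-\<delta>\<close> in every round. Markov's inequality gives a
  geometric tail for the number of rounds, and the cost of a round is linear in the size of the
  cover.
\<close>

section \<open>Covers of a region and admissible configurations\<close>

text \<open>The potential that contracts is the number of elements of a cover, not the number of
  variables of the region. Covers have the type of an update set, so that the initial one is
  \<open>D\<close> itself; all later ones consist of constraints only.\<close>

definition valid_cover :: "'v graphical_model \<Rightarrow> ('v + 'v set) set \<Rightarrow> bool" where
  "valid_cover J D \<longleftrightarrow>
     (\<forall>v. Inl v \<in> D \<longrightarrow> v \<in> gm_vars J) \<and> (\<forall>e. Inr e \<in> D \<longrightarrow> e \<in> gm_cons J)"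

text \<open>Values outside \<open>gm_vars J\<close> stay free. The condition ensures that each
  \<open>restrict X e\<close> lies in \<open>assignments J e\<close>, where the bounds on the
  constraint functions apply.\<close>

definition in_domain :: "'v graphical_model \<Rightarrow> ('v \<Rightarrow> nat) \<Rightarrow> bool" where
  "in_domain J X \<longleftrightarrow> (\<forall>v\<in>gm_vars J. X v \<in> {1..gm_q J})"

lemma bernoulli_pmf_True_le:
  assumes "p \<le> c" "0 \<le> p" "p \<le> 1"
  shows "emeasure (measure_pmf (bernoulli_pmf p)) {True} \<le> ennreal c"
  using assms by (simp add: emeasure_pmf_single ennreal_leI)

section \<open>Tail indicators and cost of a run\<close>

text \<open>A nonterminating run exceeds every \<open>k\<close>, so tail bounds on this indicator
  also control the mass of \<open>None\<close>.\<close>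

definition exceeds :: "nat \<Rightarrow> ('x \<times> nat \<times> nat) option \<Rightarrow> ennreal" where
  "exceeds k \<omega> = (case \<omega> of None \<Rightarrow> 1 | Some (_, t, _) \<Rightarrow> if k < t then 1 else 0)"

lemma exceeds_le_1: "exceeds k \<omega> \<le> 1"
  by (auto simp: exceeds_def split: option.split)

text \<open>The integrand of \<open>expected_resamplings\<close>, named so that it can be
  truncated.\<close>

definition cost :: "('x \<times> nat \<times> nat) option \<Rightarrow> ennreal" where
  "cost \<omega> = (case \<omega> of None \<Rightarrow> \<infinity> | Some (_, _, n) \<Rightarrow> of_nat n)"

text \<open>Layer-cake formula: exactly \<open>t\<close> indices lie below \<open>t\<close>, and
  \<open>None\<close> contributes infinitely many ones. It turns tail bounds into an
  expectation.\<close>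

lemma suminf_exceeds:
  "(\<Sum>k. exceeds k \<omega>) = (case \<omega> of None \<Rightarrow> \<infinity> | Some (_, t, _) \<Rightarrow> of_nat t)"
proof (cases \<omega>)
  case None
  then show ?thesis
    by (simp add: exceeds_def suminf_eq_SUP ennreal_SUP_of_nat_eq_top)
next
  case (Some s)
  then obtain x t n where \<omega>: "\<omega> = Some (x, t, n)" by (cases s) auto
  have "(\<Sum>k. exceeds k \<omega>) = (\<Sum>k<t. exceeds k \<omega>)"
    by (rule suminf_finite) (auto simp: exceeds_def \<omega>)
  then show ?thesis by (simp add: exceeds_def \<omega>)
qed

section \<open>Truncated geometric sums\<close>

text \<open>The first \<open>m\<close> summands are at most 1 each, the others are dominated by a
  geometric series starting at \<open>y * r ^ m\<close>. The induction peels off one summand and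
  moves a factor \<open>r\<close> into \<open>y\<close>, which is therefore generalised.\<close>

lemma sum_min_one_geometric:
  fixes r y :: real
  assumes r: "0 \<le> r" "r < 1" and "0 \<le> y"
  shows "(\<Sum>k<n. min 1 (y * r ^ k)) \<le> m + y * r ^ m / (1 - r)"
  using assms(3)
proof (induction m arbitrary: n y)
  case 0
  have "(\<Sum>k<n. min 1 (y * r ^ k)) \<le> (\<Sum>k<n. y * r ^ k)"
    by (intro sum_mono) simp
  also have "\<dots> = y * ((1 - r ^ n) / (1 - r))"
    using r by (simp add: sum_gp_strict flip: sum_distrib_left)
  also have "\<dots> \<le> y * (1 / (1 - r))"
    using r 0 by (intro mult_left_mono divide_right_mono) auto
  finally show ?case by simp
next
  case (Suc m)
  show ?case
  proof (cases n)
    case 0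
    then show ?thesis using r Suc.prems by simp
  next
    case (Suc n')
    have "(\<Sum>k<n. min 1 (y * r ^ k)) \<le> 1 + (\<Sum>k<n'. min 1 ((y * r) * r ^ k))"
      unfolding Suc sum.lessThan_Suc_shift by (intro add_mono) (simp_all add: mult_ac)
    also have "\<dots> \<le> 1 + (m + (y * r) * r ^ m / (1 - r))"
      using r Suc.prems by (intro add_left_mono Suc.IH) simp
    finally show ?thesis by (simp add: mult_ac)
  qed
qed

text \<open>The splitting point is chosen where the geometric term has dropped below 1, which takes
  about \<open>ln y / (1 - r)\<close> summands.\<close>

lemma sum_min_one_geometric_le_ln:
  fixes r :: real and y :: nat
  assumes r: "0 \<le> r" "r < 1"
  shows "(\<Sum>k<n. min 1 (y * r ^ k)) \<le> (1 + 1 / (1 - r)) * (1 + ln y)"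
proof (cases "y = 0")
  case True
  \<comment> \<open>Since \<open>ln 0 = 0\<close>, the right-hand side is nonnegative; this case
    covers the empty update.\<close>
  then show ?thesis using r by simp
next
  case False
  define m where "m = nat \<lceil>ln y / (1 - r)\<rceil>"
  have ln: "0 \<le> ln (real y)" using False by simp
  have m: "ln y / (1 - r) \<le> m" "m \<le> ln y / (1 - r) + 1"
    using ln r unfolding m_def by (auto simp: le_of_int_ceiling)
  \<comment> \<open>From \<open>r \<le> exp (r - 1)\<close> and
    \<open>m * (1 - r) \<ge> ln y\<close> one gets \<open>y * r ^ m \<le> 1\<close>.\<close>
  have "r ^ m \<le> exp (r - 1) ^ m"
    using r exp_ge_add_one_self[of "r - 1"] by (intro power_mono) auto
  also have "\<dots> = exp (- (m * (1 - r)))"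
    by (simp add: exp_of_nat_mult[symmetric] algebra_simps)
  also have "\<dots> \<le> exp (- ln y)"
    using m(1) r by (simp add: pos_divide_le_eq)
  also have "\<dots> = 1 / y"
    using False by (simp add: exp_minus inverse_eq_divide)
  finally have "y * r ^ m \<le> 1"
    using False by (simp add: field_simps)
  have "(\<Sum>k<n. min 1 (y * r ^ k)) \<le> m + y * r ^ m / (1 - r)"
    by (rule sum_min_one_geometric) (use r in auto)
  also have "\<dots> \<le> (ln y / (1 - r) + 1) + 1 / (1 - r)"
    using m(2) \<open>y * r ^ m \<le> 1\<close> r by (intro add_mono divide_right_mono) auto
  also have "\<dots> \<le> (1 + 1 / (1 - r)) * (1 + ln y)"
    using ln by (simp add: algebra_simps add_divide_distrib)
  finally show ?thesis .
qed

section \<open>Standing assumptions and counting of incident constraints\<close>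

text \<open>Here \<open>r\<close> is the contraction factor \<open>1 - \<delta>\<close>. The
  assumption \<open>failure_rate\<close> is the lower bound on \<open>B e\<close> after squaring,
  solved for the bound \<open>1 - (B e)^2\<close> on the probability that one indicator
  fails.\<close>

locale local_sampler =
  fixes J :: "'v graphical_model" and B :: "'v set \<Rightarrow> real" and r :: real
  assumes model: "is_graphical_model J"
    and r_nonneg: "0 \<le> r" and r_less_1: "r < 1"
    and B_pos: "e \<in> gm_cons J \<Longrightarrow> 0 < B e"
    and phi_bounds: "e \<in> gm_cons J \<Longrightarrow> x \<in> assignments J e \<Longrightarrow> gm_phi_c J e x \<in> {B e..1}"
    and failure_rate: "e \<in> gm_cons J \<Longrightarrow> 1 - (B e)\<^sup>2 \<le> r / (real (max_dep_degree J) + 1)"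
begin

lemma finite_vars: "finite (gm_vars J)"
  using model by (simp add: is_graphical_model_def)

lemma cons_subset: "e \<in> gm_cons J \<Longrightarrow> e \<subseteq> gm_vars J"
  using model by (auto simp: is_graphical_model_def)

lemma cons_nonempty: "e \<in> gm_cons J \<Longrightarrow> e \<noteq> {}"
  using model by (force simp: is_graphical_model_def)

lemma finite_cons: "finite (gm_cons J)"
  by (rule finite_subset[of _ "Pow (gm_vars J)"]) (use cons_subset finite_vars in auto)

lemma finite_in_cons: "e \<in> gm_cons J \<Longrightarrow> finite e"
  using cons_subset finite_vars finite_subset by blast

lemma finite_valid_cover:
  assumes "valid_cover J D"
  shows "finite D"
proof (rule finite_subset)
  show "D \<subseteq> Inl ` gm_vars J \<union> Inr ` gm_cons J"
  proof
    fix x assume "x \<in> D"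
    with assms show "x \<in> Inl ` gm_vars J \<union> Inr ` gm_cons J"
      by (cases x) (auto simp: valid_cover_def)
  qed
qed (simp add: finite_vars finite_cons)

lemma vbl_subset: "valid_cover J D \<Longrightarrow> vbl D \<subseteq> gm_vars J"
  using cons_subset by (fastforce simp: valid_cover_def vbl_def)

text \<open>A nonempty constraint inside \<open>S\<close> meets \<open>S\<close>, so the internal
  and the boundary case merge into one condition.\<close>

lemma incident_cons_eq: "incident_cons J S = {e \<in> gm_cons J. e \<inter> S \<noteq> {}}"
  using cons_nonempty by (auto simp: incident_cons_def internal_cons_def boundary_cons_def)

lemma finite_incident_cons: "finite (incident_cons J S)"
  by (simp add: incident_cons_eq finite_cons)

text \<open>The constraints meeting \<open>e\<close> are its neighbours in the dependency graph and
  \<open>e\<close> itself.\<close>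

lemma card_incident_cons_constraint:
  assumes "e \<in> gm_cons J"
  shows "card (incident_cons J e) \<le> max_dep_degree J + 1"
proof -
  have "incident_cons J e \<subseteq> insert e (dep_neighbours J e)"
    by (auto simp: incident_cons_eq dep_neighbours_def)
  moreover have fin: "finite (dep_neighbours J e)"
    by (simp add: dep_neighbours_def finite_cons)
  ultimately have "card (incident_cons J e) \<le> card (insert e (dep_neighbours J e))"
    by (simp add: card_mono)
  also have "\<dots> \<le> card (dep_neighbours J e) + 1"
    using fin by (simp add: card_insert_if)
  also have "card (dep_neighbours J e) \<le> max_dep_degree J"
    unfolding max_dep_degree_def using assms finite_cons by (intro Max_ge) auto
  finally show ?thesis by simp
qed

text \<open>All constraints through \<open>v\<close> meet any fixed one of them, which reduces the
  count to that for a constraint.\<close>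

lemma card_incident_cons_variable: "card (incident_cons J {v}) \<le> max_dep_degree J + 1"
proof (cases "incident_cons J {v} = {}")
  case False
  then obtain e where e: "e \<in> gm_cons J" "v \<in> e"
    by (auto simp: incident_cons_eq)
  have "card (incident_cons J {v}) \<le> card (incident_cons J e)"
    by (rule card_mono[OF finite_incident_cons]) (use e in \<open>auto simp: incident_cons_eq\<close>)
  with card_incident_cons_constraint[OF e(1)] show ?thesis by linarith
qed simp

lemma card_incident_cons_vbl:
  assumes "valid_cover J D"
  shows "card (incident_cons J (vbl D)) \<le> (max_dep_degree J + 1) * card D"
proof -
  \<comment> \<open>The variables contributed by one element of the cover; the bound is then summed
    over these elements.\<close>
  define S :: "'v + 'v set \<Rightarrow> 'v set" where "S x = (case x of Inl v \<Rightarrow> {v} | Inr e \<Rightarrow> e)" for x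
  have fin: "finite D" by (rule finite_valid_cover[OF assms])
  have "incident_cons J (vbl D) \<subseteq> (\<Union>x\<in>D. incident_cons J (S x))"
  proof
    fix e assume "e \<in> incident_cons J (vbl D)"
    then obtain v where v: "e \<in> gm_cons J" "v \<in> e" "v \<in> vbl D"
      by (auto simp: incident_cons_eq)
    then obtain x where "x \<in> D" "v \<in> S x"
      by (force simp: vbl_def S_def)
    with v show "e \<in> (\<Union>x\<in>D. incident_cons J (S x))"
      by (auto simp: incident_cons_eq)
  qed
  then have "card (incident_cons J (vbl D)) \<le> card (\<Union>x\<in>D. incident_cons J (S x))"
    by (rule card_mono[rotated]) (simp add: fin finite_incident_cons)
  also have "\<dots> \<le> (\<Sum>x\<in>D. card (incident_cons J (S x)))"
    by (rule card_UN_le[OF fin])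
  also have "\<dots> \<le> (\<Sum>x\<in>D. max_dep_degree J + 1)"
  proof (rule sum_mono)
    fix x assume "x \<in> D"
    then show "card (incident_cons J (S x)) \<le> max_dep_degree J + 1"
      using assms card_incident_cons_variable card_incident_cons_constraint
      by (cases x) (auto simp: S_def valid_cover_def)
  qed
  finally show ?thesis by (simp add: mult.commute)
qed

lemma card_vbl:
  assumes "valid_cover J D" and L: "\<forall>e\<in>gm_cons J. card e \<le> L"
  shows "card (vbl D) \<le> (L + 1) * card D"
proof -
  define S :: "'v + 'v set \<Rightarrow> 'v set" where "S x = (case x of Inl v \<Rightarrow> {v} | Inr e \<Rightarrow> e)" for x
  have fin: "finite D" by (rule finite_valid_cover[OF assms(1)])
  \<comment> \<open>The summand 1 accommodates single variables even when
    \<open>L = 0\<close>.\<close>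
  have S: "finite (S x) \<and> card (S x) \<le> L + 1" if "x \<in> D" for x
    using that assms finite_in_cons by (cases x) (force simp: S_def valid_cover_def)+
  have "vbl D \<subseteq> (\<Union>x\<in>D. S x)"
    by (force simp: vbl_def S_def)
  then have "card (vbl D) \<le> card (\<Union>x\<in>D. S x)"
    by (rule card_mono[rotated]) (use fin S in auto)
  also have "\<dots> \<le> (\<Sum>x\<in>D. card (S x))"
    by (rule card_UN_le[OF fin])
  also have "\<dots> \<le> (\<Sum>x\<in>D. L + 1)"
    by (rule sum_mono) (use S in auto)
  finally show ?thesis by (simp add: mult.commute)
qed

section \<open>Probability and expected number of failures\<close>

lemma restrict_in_assignments:
  "in_domain J X \<Longrightarrow> e \<in> gm_cons J \<Longrightarrow> restrict X e \<in> assignments J e"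
  using cons_subset by (fastforce simp: in_domain_def assignments_def)

text \<open>The minimum ranges over values in \<open>[B e, 1]\<close>, one of which is the
  denominator \<open>p\<close>. Hence it is at most \<open>p\<close> and at least
  \<open>B e\<close>, and \<open>p \<le> 1\<close>.\<close>

lemma kappa_bounds:
  assumes X: "in_domain J X" and e: "e \<in> gm_cons J"
  shows "B e \<le> kappa J X R e" "kappa J X R e \<le> 1"
proof -
  define A where "A = gm_phi_c J e `
      {x \<in> assignments J e. restrict x (e \<inter> R) = restrict X (e \<inter> R)}"
  define p where "p = gm_phi_c J e (restrict X e)"
  have "finite (assignments J e)"
    unfolding assignments_def using finite_in_cons[OF e] by (intro finite_PiE) auto
  then have fin: "finite A" by (simp add: A_def)
  \<comment> \<open>\<open>X\<close> agrees with itself on \<open>e \<inter> R\<close>, so its own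
    value competes in the minimum.\<close>
  have pA: "p \<in> A"
    unfolding A_def p_def using restrict_in_assignments[OF X e]
    by (intro imageI) (auto simp: restrict_def fun_eq_iff)
  have A: "a \<in> {B e..1}" if "a \<in> A" for a
    using that phi_bounds[OF e] by (auto simp: A_def)
  have "Min A \<in> A" using fin pA by (intro Min_in) auto
  then have m: "B e \<le> Min A" using A by auto
  have "Min A \<le> p" using fin pA by simp
  have p: "B e \<le> p" "p \<le> 1" using A[OF pA] by auto
  have pos: "0 < B e" by (rule B_pos[OF e])
  \<comment> \<open>Positivity of \<open>p\<close> excludes the \<open>0/0\<close> branch.\<close>
  have k: "kappa J X R e = Min A / p"
    using p pos by (simp add: kappa_def Let_def A_def p_def)
  have "B e * p \<le> B e * 1" using p pos by (intro mult_left_mono) auto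
  then have "B e * p \<le> Min A" using m by simp
  then show "B e \<le> kappa J X R e"
    using p pos by (simp add: k pos_le_divide_eq)
  show "kappa J X R e \<le> 1"
    using \<open>Min A \<le> p\<close> p pos by (simp add: k)
qed

text \<open>Success has probability at least \<open>(B e)^2\<close>: one factor \<open>B e\<close>
  comes from \<open>kappa\<close> at the old configuration, the other from the constraint function
  at the new one.\<close>

lemma failure_probability:
  assumes X: "in_domain J X" and X': "in_domain J X'" and e: "e \<in> gm_cons J"
  shows "emeasure (measure_pmf (bernoulli_pmf
      (1 - kappa J X R e * gm_phi_c J e (restrict X' e)))) {True}
    \<le> ennreal (r / (real (max_dep_degree J) + 1))"
proof (rule bernoulli_pmf_True_le)
  note k = kappa_bounds[OF X e, of R]
  have phi: "B e \<le> gm_phi_c J e (restrict X' e)" "gm_phi_c J e (restrict X' e) \<le> 1"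
    using phi_bounds[OF e restrict_in_assignments[OF X' e]] by auto
  note pos = B_pos[OF e]
  have "B e * B e \<le> kappa J X R e * gm_phi_c J e (restrict X' e)"
    using k phi pos by (intro mult_mono) auto
  then show "1 - kappa J X R e * gm_phi_c J e (restrict X' e)
      \<le> r / (real (max_dep_degree J) + 1)"
    using failure_rate[OF e] by (simp add: power2_eq_square)
  have "kappa J X R e * gm_phi_c J e (restrict X' e) \<le> 1 * 1"
    using k phi pos by (intro mult_mono) auto
  then show "0 \<le> 1 - kappa J X R e * gm_phi_c J e (restrict X' e)" by simp
  show "1 - kappa J X R e * gm_phi_c J e (restrict X' e) \<le> 1"
    using k phi pos by simp
qed

text \<open>Linearity of expectation: at most \<open>(d+1) |D|\<close> indicators, each failing with
  probability at most \<open>r / (d+1)\<close>, so the degree cancels.\<close>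

lemma expected_failures:
  assumes D: "valid_cover J D" and X: "in_domain J X" and X': "in_domain J X'"
  shows "(\<integral>\<^sup>+F. of_nat (card {e \<in> incident_cons J (vbl D). F e})
      \<partial>measure_pmf (Pi_pmf (incident_cons J (vbl D)) False
        (\<lambda>e. bernoulli_pmf (1 - kappa J X (vbl D) e * gm_phi_c J e (restrict X' e)))))
    \<le> ennreal r * of_nat (card D)"
proof -
  let ?A = "incident_cons J (vbl D)"
  let ?b = "\<lambda>e. bernoulli_pmf (1 - kappa J X (vbl D) e * gm_phi_c J e (restrict X' e))"
  let ?P = "Pi_pmf ?A False ?b"
  let ?d = "real (max_dep_degree J) + 1"
  have fin: "finite ?A" by (rule finite_incident_cons)
  have "(\<integral>\<^sup>+F. of_nat (card {e \<in> ?A. F e}) \<partial>?P)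
      = (\<integral>\<^sup>+F. (\<Sum>e\<in>?A. indicator {True} (F e)) \<partial>?P)"
  proof (rule nn_integral_cong)
    fix F
    have "(\<Sum>e\<in>?A. indicator {True} (F e)) = (\<Sum>e\<in>?A. if F e then 1 else 0 :: ennreal)"
      by (intro sum.cong) (auto simp: indicator_def)
    also have "\<dots> = (\<Sum>e\<in>{e \<in> ?A. F e}. 1)"
      by (rule sum.inter_filter[OF fin, symmetric])
    finally show "of_nat (card {e \<in> ?A. F e}) = (\<Sum>e\<in>?A. indicator {True} (F e) :: ennreal)"
      by simp
  qed
  also have "\<dots> = (\<Sum>e\<in>?A. \<integral>\<^sup>+F. indicator {True} (F e) \<partial>?P)"
    by (rule nn_integral_sum) simp
  also have "\<dots> = (\<Sum>e\<in>?A. emeasure (measure_pmf (?b e)) {True})"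
  proof (rule sum.cong[OF refl])
    fix e assume "e \<in> ?A"
    \<comment> \<open>The marginal of the product distribution at coordinate \<open>e\<close> is the
      single Bernoulli factor.\<close>
    then have "map_pmf (\<lambda>F. F e) ?P = ?b e"
      using Pi_pmf_component[OF fin, of e False ?b] by simp
    then have "(\<integral>\<^sup>+b. indicator {True} b \<partial>measure_pmf (?b e))
        = (\<integral>\<^sup>+b. indicator {True} b \<partial>measure_pmf (map_pmf (\<lambda>F. F e) ?P))"
      by simp
    then show "(\<integral>\<^sup>+F. indicator {True} (F e) \<partial>?P) = emeasure (measure_pmf (?b e)) {True}"
      by simp
  qed
  also have "\<dots> \<le> (\<Sum>e\<in>?A. ennreal (r / ?d))"
    by (intro sum_mono failure_probability X X') (auto simp: incident_cons_eq)
  also have "\<dots> = ennreal (real (card ?A) * (r / ?d))"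
    using r_nonneg
    by (simp add: ennreal_of_nat_eq_real_of_nat ennreal_mult[symmetric] del: times_divide_eq_right)
  also have "\<dots> \<le> ennreal (real ((max_dep_degree J + 1) * card D) * (r / ?d))"
    by (intro ennreal_leI mult_right_mono of_nat_mono card_incident_cons_vbl D)
      (use r_nonneg in auto)
  also have "real ((max_dep_degree J + 1) * card D) * (r / ?d) = r * real (card D)"
    by (simp add: field_simps)
  also have "ennreal (r * real (card D)) = ennreal r * of_nat (card D)"
    using r_nonneg by (simp add: ennreal_mult ennreal_of_nat_eq_real_of_nat)
  finally show ?thesis .
qed

section \<open>Contraction in one round\<close>

text \<open>The drift estimate behind both inductions on rounds: a bound affine in the size of the
  next cover is averaged by replacing that size with \<open>r |D|\<close>. The tail estimate takes
  \<open>a = 0\<close>; the cost estimate takes for \<open>a\<close> the samplings counted so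
  far.\<close>

lemma nn_integral_local_resample_le:
  fixes h :: "('v \<Rightarrow> nat) \<times> 'v set \<Rightarrow> ennreal"
  assumes D: "valid_cover J D" and X: "in_domain J X"
    and h: "\<And>X' D'. in_domain J X' \<Longrightarrow> valid_cover J D' \<Longrightarrow>
      h (X', vbl D') \<le> a + b * of_nat (card D')"
  shows "(\<integral>\<^sup>+s. h s \<partial>measure_pmf (local_resample J X (vbl D)))
    \<le> a + b * (ennreal r * of_nat (card D))"
proof -
  let ?R = "vbl D"
  let ?A = "incident_cons J ?R"
  let ?X' = "\<lambda>Y v. if v \<in> ?R then Y v else X v"
  let ?P = "\<lambda>Y. Pi_pmf ?A False
    (\<lambda>e. bernoulli_pmf (1 - kappa J X ?R e * gm_phi_c J e (restrict (?X' Y) e)))"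
  have R: "?R \<subseteq> gm_vars J" by (rule vbl_subset[OF D])
  then have finR: "finite ?R" using finite_vars finite_subset by blast
  have dom: "in_domain J (?X' Y)" if "Y \<in> set_pmf (Pi_pmf ?R undefined (gm_phi_v J))" for Y
  proof -
    have "Y v \<in> set_pmf (gm_phi_v J v)" if "v \<in> ?R" for v
      using \<open>Y \<in> _\<close> that finR by (auto simp: set_Pi_pmf PiE_dflt_def)
    then show ?thesis
      using X R model unfolding in_domain_def is_graphical_model_def by fastforce
  qed
  \<comment> \<open>Uniform in the resampled values \<open>Y\<close>, so that averaging over
    \<open>Y\<close> afterwards preserves the bound.\<close>
  have inner: "(\<integral>\<^sup>+F. h (?X' Y, \<Union>{e \<in> ?A. F e}) \<partial>measure_pmf (?P Y))
      \<le> a + b * (ennreal r * of_nat (card D))"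
    if Y: "Y \<in> set_pmf (Pi_pmf ?R undefined (gm_phi_v J))" for Y
  proof -
    have "(\<integral>\<^sup>+F. h (?X' Y, \<Union>{e \<in> ?A. F e}) \<partial>measure_pmf (?P Y))
        \<le> (\<integral>\<^sup>+F. a + b * of_nat (card {e \<in> ?A. F e}) \<partial>measure_pmf (?P Y))"
    proof (rule nn_integral_mono)
      fix F
      \<comment> \<open>The failed constraints themselves serve as the cover of the next
        region.\<close>
      let ?D' = "Inr ` {e \<in> ?A. F e} :: ('v + 'v set) set"
      have "valid_cover J ?D'" by (auto simp: valid_cover_def incident_cons_eq)
      moreover have "vbl ?D' = \<Union>{e \<in> ?A. F e}" by (auto simp: vbl_def)
      moreover have "card ?D' = card {e \<in> ?A. F e}" by (simp add: card_image)
      ultimately show "h (?X' Y, \<Union>{e \<in> ?A. F e}) \<le> a + b * of_nat (card {e \<in> ?A. F e})"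
        using h[OF dom[OF Y], of ?D'] by simp
    qed
    also have "\<dots> = a + b * (\<integral>\<^sup>+F. of_nat (card {e \<in> ?A. F e}) \<partial>measure_pmf (?P Y))"
      by (simp add: nn_integral_add nn_integral_cmult)
    also have "\<dots> \<le> a + b * (ennreal r * of_nat (card D))"
      by (intro add_left_mono mult_left_mono expected_failures D X dom Y) simp
    finally show ?thesis .
  qed
  have "(\<integral>\<^sup>+s. h s \<partial>measure_pmf (local_resample J X ?R))
      = (\<integral>\<^sup>+Y. (\<integral>\<^sup>+F. h (?X' Y, \<Union>{e \<in> ?A. F e}) \<partial>measure_pmf (?P Y))
          \<partial>measure_pmf (Pi_pmf ?R undefined (gm_phi_v J)))"
    by (simp add: local_resample_def Let_def)
  also have "\<dots> \<le> (\<integral>\<^sup>+Y. a + b * (ennreal r * of_nat (card D))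
          \<partial>measure_pmf (Pi_pmf ?R undefined (gm_phi_v J)))"
    by (intro nn_integral_mono_AE) (simp add: AE_measure_pmf_iff inner)
  finally show ?thesis by simp
qed

lemma sampler_loop_empty: "sampler_loop J X {} t n = return_spmf (X, t, n)"
  by (subst sampler_loop.simps) simp

lemma nn_integral_sampler_loop_step:
  assumes "R \<noteq> {}"
  shows "(\<integral>\<^sup>+\<omega>. f \<omega> \<partial>measure_pmf (sampler_loop J X R t n))
    = (\<integral>\<^sup>+s. (\<integral>\<^sup>+\<omega>. f \<omega> \<partial>measure_pmf (sampler_loop J (fst s) (snd s) (t + 1)
          (n + card R + card (incident_cons J R)))) \<partial>measure_pmf (local_resample J X R))"
  using assms by (subst sampler_loop.simps) (simp add: case_prod_beta)

text \<open>This is how Markov's inequality enters: the indicator of a further round is dominated by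
  the size of the cover.\<close>

lemma one_le_card_cover:
  assumes "valid_cover J D" "vbl D \<noteq> {}"
  shows "1 \<le> (of_nat (card D) :: ennreal)"
proof -
  have "D \<noteq> {}" using assms(2) by (auto simp: vbl_def)
  then have "1 \<le> card D"
    using finite_valid_cover[OF assms(1)] by (simp add: Suc_leI card_gt_0_iff)
  then show ?thesis by (metis of_nat_1 of_nat_mono)
qed

section \<open>Geometric tail of the number of rounds\<close>

text \<open>Each round multiplies the expected cover size by at most \<open>r\<close>, and a run
  exceeds \<open>k\<close> further rounds only if the region is still nonempty after them. The
  counters are generalised because the loop carries them along.\<close>

lemma iteration_tail:
  assumes "valid_cover J D" "in_domain J X"
  shows "(\<integral>\<^sup>+\<omega>. exceeds (t + k) \<omega> \<partial>measure_pmf (sampler_loop J X (vbl D) t n))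
    \<le> ennreal (r ^ k) * of_nat (card D)"
  using assms
proof (induction k arbitrary: X D t n)
  case 0
  show ?case
  proof (cases "vbl D = {}")
    case True
    then show ?thesis by (simp add: sampler_loop_empty exceeds_def)
  next
    case False
    have "(\<integral>\<^sup>+\<omega>. exceeds (t + 0) \<omega> \<partial>measure_pmf (sampler_loop J X (vbl D) t n))
        \<le> (\<integral>\<^sup>+\<omega>. 1 \<partial>measure_pmf (sampler_loop J X (vbl D) t n))"
      by (intro nn_integral_mono exceeds_le_1)
    also have "\<dots> \<le> of_nat (card D)"
      using one_le_card_cover[OF 0(1) False] by simp
    finally show ?thesis by simp
  qed
next
  case (Suc k)
  show ?case
  proof (cases "vbl D = {}")
    case True
    then show ?thesis by (simp add: sampler_loop_empty exceeds_def)
  next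
    case False
    have "(\<integral>\<^sup>+\<omega>. exceeds (t + Suc k) \<omega> \<partial>measure_pmf (sampler_loop J X (vbl D) t n))
        \<le> 0 + ennreal (r ^ k) * (ennreal r * of_nat (card D))"
      unfolding nn_integral_sampler_loop_step[OF False]
    proof (rule nn_integral_local_resample_le[OF Suc.prems])
      \<comment> \<open>Reading \<open>t + Suc k\<close> as \<open>(t + 1) + k\<close> makes the
        induction hypothesis fit the incremented counter.\<close>
      fix X' D' assume "in_domain J X'" "valid_cover J D'"
      then show "(\<integral>\<^sup>+\<omega>. exceeds (t + Suc k) \<omega> \<partial>measure_pmf (sampler_loop J
            (fst (X', vbl D')) (snd (X', vbl D')) (t + 1)
            (n + card (vbl D) + card (incident_cons J (vbl D)))))
          \<le> 0 + ennreal (r ^ k) * of_nat (card D')"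
        using Suc.IH[of D' X' "t + 1"] by simp
    qed
    also have "\<dots> = ennreal (r ^ Suc k) * of_nat (card D)"
      using r_nonneg by (simp add: ennreal_mult ennreal_power[symmetric] mult_ac)
    finally show ?thesis .
  qed
qed

section \<open>Expected cost by truncation\<close>

text \<open>
  The truncation at \<open>N\<close> makes the first \<open>k\<close> rounds determine the cost up to the error
  \<open>N r\<^sup>k |D|\<close>, so the bound follows by induction on \<open>k\<close> without knowing that the loop terminates.
\<close>

lemma truncated_cost:
  assumes "valid_cover J D" "in_domain J X"
    and c: "\<And>D. valid_cover J D \<Longrightarrow>
      card (vbl D) + card (incident_cons J (vbl D)) \<le> c * card D"
  shows "(\<integral>\<^sup>+\<omega>. min (cost \<omega>) (of_nat N) \<partial>measure_pmf (sampler_loop J X (vbl D) t n))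
    \<le> of_nat n + ennreal (c / (1 - r) + N * r ^ k) * of_nat (card D)"
  using assms(1,2)
proof (induction k arbitrary: X D t n)
  case 0
  show ?case
  proof (cases "vbl D = {}")
    case True
    then show ?thesis
      by (simp add: sampler_loop_empty cost_def min.coboundedI1)
  next
    case False
    have "(\<integral>\<^sup>+\<omega>. min (cost \<omega>) (of_nat N) \<partial>measure_pmf (sampler_loop J X (vbl D) t n))
        \<le> (\<integral>\<^sup>+\<omega>. of_nat N \<partial>measure_pmf (sampler_loop J X (vbl D) t n))"
      by (intro nn_integral_mono) simp
    also have "\<dots> = ennreal (real N) * 1" by (simp add: ennreal_of_nat_eq_real_of_nat)
    \<comment> \<open>A nonempty region has \<open>|D| \<ge> 1\<close>, so the error term at
      \<open>k = 0\<close> alone absorbs the truncation level \<open>N\<close>.\<close>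
    also have "\<dots> \<le> ennreal (c / (1 - r) + N * r ^ 0) * of_nat (card D)"
      using r_less_1 one_le_card_cover[OF 0(1) False] by (intro mult_mono ennreal_leI) auto
    also have "\<dots> \<le> of_nat n + \<dots>" by simp
    finally show ?thesis .
  qed
next
  case (Suc k)
  show ?case
  proof (cases "vbl D = {}")
    case True
    then show ?thesis
      by (simp add: sampler_loop_empty cost_def min.coboundedI1)
  next
    case False
    let ?n = "n + card (vbl D) + card (incident_cons J (vbl D))"
    let ?b = "c / (1 - r) + N * r ^ k"
    have b: "0 \<le> ?b" using r_less_1 r_nonneg by simp
    have "(\<integral>\<^sup>+\<omega>. min (cost \<omega>) (of_nat N) \<partial>measure_pmf (sampler_loop J X (vbl D) t n))
        \<le> of_nat ?n + ennreal ?b * (ennreal r * of_nat (card D))"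
      unfolding nn_integral_sampler_loop_step[OF False]
      by (rule nn_integral_local_resample_le[OF Suc.prems]) (simp only: fst_conv snd_conv Suc.IH)
    also have "\<dots> = ennreal (real ?n + ?b * (r * real (card D)))"
      using b r_nonneg
      by (simp only: ennreal_of_nat_eq_real_of_nat ennreal_mult[symmetric] ennreal_plus[symmetric]
          of_nat_0_le_iff mult_nonneg_nonneg)
    also have "\<dots> \<le> ennreal (real n + (c / (1 - r) + N * r ^ Suc k) * real (card D))"
    proof (rule ennreal_leI)
      have "real ?n \<le> real n + real c * real (card D)"
        using c[OF Suc.prems(1)] by (metis add.assoc add_left_mono of_nat_add of_nat_mono of_nat_mult)
      \<comment> \<open>\<open>a\<close> solves \<open>a = c + a * r\<close>: the cost of the
        current round plus the contracted cost of all later ones, per element of the cover.\<close>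
      moreover define a where "a = c / (1 - r)"
      have "real c + a * r = a"
        using r_less_1 by (simp add: a_def field_simps)
      then have "(a + N * r ^ Suc k) * real (card D) = ((c + a * r) + N * r ^ Suc k) * real (card D)"
        by simp
      then have "real c * real (card D) + ?b * (r * real (card D))
          = (c / (1 - r) + N * r ^ Suc k) * real (card D)"
        unfolding a_def[symmetric] by (simp add: algebra_simps)
      ultimately show "real ?n + ?b * (r * real (card D))
          \<le> real n + (c / (1 - r) + N * r ^ Suc k) * real (card D)"
        by linarith
    qed
    also have "\<dots> = of_nat n + ennreal (c / (1 - r) + N * r ^ Suc k) * of_nat (card D)"
      using r_nonneg r_less_1
      by (simp add: ennreal_of_nat_eq_real_of_nat ennreal_mult ennreal_plus)
    finally show ?thesis .
  qed
qed

text \<open>Two limits in this order: at fixed \<open>N\<close> the error vanishes as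
  \<open>k\<close> grows, then the truncation is removed by monotone convergence.\<close>

lemma expected_cost:
  assumes "valid_cover J D" "in_domain J X"
    and c: "\<And>D. valid_cover J D \<Longrightarrow>
      card (vbl D) + card (incident_cons J (vbl D)) \<le> c * card D"
  shows "(\<integral>\<^sup>+\<omega>. cost \<omega> \<partial>measure_pmf (sampler_loop J X (vbl D) 0 0))
    \<le> ennreal (c / (1 - r) * card D)"
proof -
  let ?M = "measure_pmf (sampler_loop J X (vbl D) 0 0)"
  have trunc: "(\<integral>\<^sup>+\<omega>. min (cost \<omega>) (of_nat N) \<partial>?M) \<le> ennreal (c / (1 - r) * card D)" for N
  proof (rule LIMSEQ_le_const)
    have "(\<lambda>k. r ^ k) \<longlonglongrightarrow> 0"
      using r_nonneg r_less_1 by (intro LIMSEQ_power_zero) simp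
    then have "(\<lambda>k. (c / (1 - r) + N * r ^ k) * card D) \<longlonglongrightarrow> (c / (1 - r) + real N * 0) * card D"
      by (intro tendsto_mult tendsto_add tendsto_const)
    then show "(\<lambda>k. ennreal ((c / (1 - r) + N * r ^ k) * card D))
        \<longlonglongrightarrow> ennreal (c / (1 - r) * card D)"
      by (intro tendsto_ennrealI) simp
    show "\<exists>K. \<forall>k\<ge>K. (\<integral>\<^sup>+\<omega>. min (cost \<omega>) (of_nat N) \<partial>?M)
        \<le> ennreal ((c / (1 - r) + N * r ^ k) * card D)"
      using truncated_cost[OF assms, where N = N and t = 0 and n = 0] r_nonneg r_less_1
      by (simp add: ennreal_mult ennreal_of_nat_eq_real_of_nat)
  qed
  \<comment> \<open>This includes \<open>None\<close>, where both sides are infinite.\<close>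
  have "(SUP N. min (cost \<omega>) (of_nat N)) = cost \<omega>"
    for \<omega> :: "(('v \<Rightarrow> nat) \<times> nat \<times> nat) option"
    by (simp add: inf_min[symmetric] inf_SUP[symmetric] ennreal_SUP_of_nat_eq_top)
  then have "(\<integral>\<^sup>+\<omega>. cost \<omega> \<partial>?M) = (\<integral>\<^sup>+\<omega>. (SUP N. min (cost \<omega>) (of_nat N)) \<partial>?M)"
    by simp
  also have "\<dots> = (SUP N. \<integral>\<^sup>+\<omega>. min (cost \<omega>) (of_nat N) \<partial>?M)"
    by (intro nn_integral_monotone_convergence_SUP)
      (auto simp: incseq_def le_fun_def intro: min.coboundedI2)
  also have "\<dots> \<le> ennreal (c / (1 - r) * card D)"
    by (intro SUP_least trunc)
  finally show ?thesis .
qed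

section \<open>Expected numbers of iterations and resamplings\<close>

text \<open>Summing the tails. Each is bounded by 1 as well as by \<open>|D| r^k\<close>; taking the
  minimum yields a logarithm where the second bound alone would give a linear term.\<close>

lemma expected_iteration_count:
  assumes "valid_cover J D" "in_domain J X"
  shows "expected_iterations (sampler_loop J X (vbl D) 0 0)
    \<le> ennreal ((1 + 1 / (1 - r)) * (1 + ln (card D)))"
proof -
  let ?M = "measure_pmf (sampler_loop J X (vbl D) 0 0)"
  have tail: "(\<integral>\<^sup>+\<omega>. exceeds k \<omega> \<partial>?M) \<le> ennreal (min 1 (card D * r ^ k))" for k
  proof -
    have "(\<integral>\<^sup>+\<omega>. exceeds k \<omega> \<partial>?M) \<le> (\<integral>\<^sup>+\<omega>. 1 \<partial>?M)"
      by (intro nn_integral_mono exceeds_le_1)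
    moreover have "(\<integral>\<^sup>+\<omega>. exceeds k \<omega> \<partial>?M) \<le> ennreal (card D * r ^ k)"
      using iteration_tail[OF assms, where t = 0 and k = k and n = 0] r_nonneg
      by (simp add: ennreal_mult ennreal_of_nat_eq_real_of_nat mult.commute)
    ultimately show ?thesis by (simp add: min_def)
  qed
  have "expected_iterations (sampler_loop J X (vbl D) 0 0) = (\<integral>\<^sup>+\<omega>. (\<Sum>k. exceeds k \<omega>) \<partial>?M)"
    unfolding expected_iterations_def suminf_exceeds ..
  also have "\<dots> = (\<Sum>k. \<integral>\<^sup>+\<omega>. exceeds k \<omega> \<partial>?M)"
    by (rule nn_integral_suminf) simp
  also have "\<dots> \<le> ennreal ((1 + 1 / (1 - r)) * (1 + ln (card D)))"
    unfolding suminf_eq_SUP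
  proof (rule SUP_least)
    fix n
    have "(\<Sum>k<n. \<integral>\<^sup>+\<omega>. exceeds k \<omega> \<partial>?M) \<le> (\<Sum>k<n. ennreal (min 1 (card D * r ^ k)))"
      by (intro sum_mono tail)
    also have "\<dots> = ennreal (\<Sum>k<n. min 1 (card D * r ^ k))"
      using r_nonneg by (intro sum_ennreal) simp
    also have "\<dots> \<le> ennreal ((1 + 1 / (1 - r)) * (1 + ln (card D)))"
      by (intro ennreal_leI sum_min_one_geometric_le_ln r_nonneg r_less_1)
    finally show "(\<Sum>k<n. \<integral>\<^sup>+\<omega>. exceeds k \<omega> \<partial>?M)
        \<le> ennreal ((1 + 1 / (1 - r)) * (1 + ln (card D)))" .
  qed
  finally show ?thesis .
qed

text \<open>A round draws at most \<open>(L+1) |D|\<close> variables and \<open>(K+1) |D|\<close>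
  indicators, whence the constant \<open>K + L + 2\<close>.\<close>

lemma expected_resampling_count:
  assumes "valid_cover J D" "in_domain J X"
    and K: "max_dep_degree J \<le> K" and L: "\<forall>e\<in>gm_cons J. card e \<le> L"
  shows "expected_resamplings (sampler_loop J X (vbl D) 0 0)
    \<le> ennreal (real (K + L + 2) / (1 - r) * card D)"
  unfolding expected_resamplings_def cost_def[symmetric]
proof (rule expected_cost[OF assms(1,2)])
  fix D assume D: "valid_cover J D"
  have "card (incident_cons J (vbl D)) \<le> (K + 1) * card D"
    using card_incident_cons_vbl[OF D] mult_right_mono[of "max_dep_degree J + 1" "K + 1" "card D"] K
    by linarith
  with card_vbl[OF D L]
  show "card (vbl D) + card (incident_cons J (vbl D)) \<le> (K + L + 2) * card D"
    by (simp add: algebra_simps)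
qed

end

section \<open>Transfer to the updated model and random input\<close>

lemma is_graphical_model_apply_update:
  assumes "is_graphical_model I" "is_update I U"
  shows "is_graphical_model (apply_update I U)"
  using assms
  unfolding is_graphical_model_def is_update_def apply_update_def assignments_def by auto

lemma valid_cover_upd_set:
  "is_update I U \<Longrightarrow> valid_cover (apply_update I U) (upd_set U)"
  by (auto simp: is_update_def valid_cover_def apply_update_def)

text \<open>An update changes neither the variables nor their domain, so inputs drawn for the old
  model are admissible for the new one.\<close>

lemma in_domain_gibbs_support:
  assumes "is_gibbs I \<mu>" "X \<in> set_pmf \<mu>"
  shows "in_domain (apply_update I U) X"
proof -
  have "X \<in> assignments I (gm_vars I)"
    using assms by (metis is_gibbs_def pmf_eq_0_set_pmf)
  then show ?thesis by (auto simp: in_domain_def apply_update_def assignments_def)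
qed

lemma nn_integral_sampler_run_le:
  assumes "is_gibbs I \<mu>"
    and "\<And>X. in_domain (apply_update I U) X \<Longrightarrow>
      (\<integral>\<^sup>+\<omega>. f \<omega> \<partial>measure_pmf (dynamic_sampler I X U)) \<le> c"
  shows "(\<integral>\<^sup>+\<omega>. f \<omega> \<partial>measure_pmf (sampler_run I \<mu> U)) \<le> c"
proof -
  have "(\<integral>\<^sup>+\<omega>. f \<omega> \<partial>measure_pmf (sampler_run I \<mu> U))
      = (\<integral>\<^sup>+X. \<integral>\<^sup>+\<omega>. f \<omega> \<partial>measure_pmf (dynamic_sampler I X U) \<partial>measure_pmf \<mu>)"
    by (simp add: sampler_run_def)
  also have "\<dots> \<le> (\<integral>\<^sup>+X. c \<partial>measure_pmf \<mu>)"
    by (intro nn_integral_mono_AE)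
      (simp add: AE_measure_pmf_iff assms(2) in_domain_gibbs_support[OF assms(1)])
  finally show ?thesis by simp
qed

text \<open>The constants are quantified before the models, as the O-notation demands. The summand 1
  beside the logarithm is there because \<open>ln 1 = 0\<close>, while an update of size 1 already
  causes a round.\<close>

theorem theorem2:
  fixes \<delta> :: real
  assumes "0 < \<delta>" and "\<delta> < 1"
  shows "\<exists>(C :: real) (C' :: nat \<Rightarrow> nat \<Rightarrow> real).
    \<forall>(I :: 'v graphical_model) (U :: 'v gm_update) (\<mu> :: ('v \<Rightarrow> nat) pmf)
      (I' :: 'v graphical_model) (B :: 'v set \<Rightarrow> real).
      is_graphical_model I \<longrightarrow> is_update I U \<longrightarrow> I' = apply_update I U \<longrightarrow> is_gibbs I \<mu> \<longrightarrow>
      (\<forall>e\<in>gm_cons I'. 0 < B e \<and> B e \<le> 1 \<and>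
         (\<forall>x\<in>assignments I' e. gm_phi_c I' e x \<in> {B e..1})) \<longrightarrow>
      (\<forall>e\<in>gm_cons I'.
         B e \<ge> (1 - (1 - \<delta>) / (real (max_dep_degree I') + 1)) powr (1 / 2)) \<longrightarrow>
      expected_iterations (sampler_run I \<mu> U)
        \<le> ennreal (C * (1 + ln (real (card (upd_set U))))) \<and>
      (\<forall>K L. max_dep_degree I' \<le> K \<longrightarrow> (\<forall>e\<in>gm_cons I'. card e \<le> L) \<longrightarrow>
         expected_resamplings (sampler_run I \<mu> U)
           \<le> ennreal (C' K L * real (card (upd_set U))))"
\<comment> \<open>The witnesses are fixed by the bounds shown below:
  \<open>C = 1 + 1 / \<delta>\<close> and \<open>C' K L = (K + L + 2) / \<delta>\<close>, as
  \<open>1 - r = \<delta>\<close>.\<close>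
proof (intro exI allI impI conjI)
  fix I :: "'v graphical_model" and U :: "'v gm_update" and \<mu> :: "('v \<Rightarrow> nat) pmf"
    and I' :: "'v graphical_model" and B :: "'v set \<Rightarrow> real"
  assume I: "is_graphical_model I" and U: "is_update I U" and I': "I' = apply_update I U"
    and gibbs: "is_gibbs I \<mu>"
    and B: "\<forall>e\<in>gm_cons I'. 0 < B e \<and> B e \<le> 1 \<and>
         (\<forall>x\<in>assignments I' e. gm_phi_c I' e x \<in> {B e..1})"
    and B_ge: "\<forall>e\<in>gm_cons I'.
         B e \<ge> (1 - (1 - \<delta>) / (real (max_dep_degree I') + 1)) powr (1 / 2)"
  interpret local_sampler I' B "1 - \<delta>"
  proof
    show "is_graphical_model I'"
      unfolding I' by (rule is_graphical_model_apply_update[OF I U])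
    fix e assume e: "e \<in> gm_cons I'"
    let ?s = "1 - (1 - \<delta>) / (real (max_dep_degree I') + 1)"
    \<comment> \<open>As \<open>1 - \<delta> < 1 \<le> d + 1\<close>, the radicand is nonnegative,
      so the power \<open>1/2\<close> is a square root and can be squared away.\<close>
    have s: "0 \<le> ?s"
      using assms by (simp add: field_simps)
    then have "sqrt ?s \<le> B e"
      using B_ge e by (simp add: powr_half_sqrt)
    then have "?s \<le> (B e)\<^sup>2"
      by (rule sqrt_le_D)
    then show "1 - (B e)\<^sup>2 \<le> (1 - \<delta>) / (real (max_dep_degree I') + 1)"
      by linarith
  qed (use assms B in auto)
  have cover: "valid_cover I' (upd_set U)"
    unfolding I' by (rule valid_cover_upd_set[OF U])
  show "expected_iterations (sampler_run I \<mu> U)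
      \<le> ennreal ((1 + 1 / \<delta>) * (1 + ln (real (card (upd_set U)))))"
    unfolding expected_iterations_def
  proof (rule nn_integral_sampler_run_le[OF gibbs, where U = U, folded I'])
    fix X assume "in_domain I' X"
    from expected_iteration_count[OF cover this]
    show "(\<integral>\<^sup>+\<omega>. (case \<omega> of None \<Rightarrow> \<infinity> | Some (_, t, _) \<Rightarrow> of_nat t)
        \<partial>measure_pmf (dynamic_sampler I X U))
        \<le> ennreal ((1 + 1 / \<delta>) * (1 + ln (real (card (upd_set U)))))"
      by (simp add: expected_iterations_def dynamic_sampler_def I')
  qed
  fix K L
  assume K: "max_dep_degree I' \<le> K" and L: "\<forall>e\<in>gm_cons I'. card e \<le> L"
  show "expected_resamplings (sampler_run I \<mu> U)
      \<le> ennreal ((\<lambda>K L. real (K + L + 2) / \<delta>) K L * real (card (upd_set U)))"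
    unfolding expected_resamplings_def
  proof (rule nn_integral_sampler_run_le[OF gibbs, where U = U, folded I'])
    fix X assume "in_domain I' X"
    from expected_resampling_count[OF cover this K L]
    show "(\<integral>\<^sup>+\<omega>. (case \<omega> of None \<Rightarrow> \<infinity> | Some (_, _, n) \<Rightarrow> of_nat n)
        \<partial>measure_pmf (dynamic_sampler I X U))
        \<le> ennreal ((\<lambda>K L. real (K + L + 2) / \<delta>) K L * real (card (upd_set U)))"
      by (simp add: expected_resamplings_def dynamic_sampler_def I')
  qed
qed

end
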